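(* Let $G$ be the triangular lattice on $N=n^2$ vertices. Then \[ \lim_{N\to\infty}\frac{\sup_{p\in(0,1)}\mathbb{E}[C_p]}{N}\in(0.09629,\,0.10107), \] where the limit is taken along $N=n^2$, $n\to\infty$.
   Context: The triangular lattice on $N=n^2$ vertices (a parallelogram-shaped piece of the infinite triangular lattice) is the graph with vertex set $\{1,\ldots,n\}^2$ in which $(i,j)$ is adjacent to $(i+1,j)$, $(i,j+1)$ and $(i+1,j-1)$ whenever these belong to the vertex set (and there are no other edges). For a graph $G$ and $p\in[0,1]$, each vertex of $G$ is declared open with probability $p$ and closed with probability $1-p$, independently of the other vertices; $G_p$ is the subgraph of $G$ induced by the open vertices, and $C_p$ is the number of connected components of $G_p$. *)

theory Defs
  imports "HOL-Probability.Probability" "Graph_Theory.Graph_Theory"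
begin

definition tri_step :: "int \<times> int \<Rightarrow> int \<times> int \<Rightarrow> bool" where
  "tri_step u v \<longleftrightarrow> (case u of (i, j) \<Rightarrow> v \<in> {(i + 1, j), (i, j + 1), (i + 1, j - 1)})"

text \<open>
  Undirected graphs are represented, as usual in \<open>Graph_Theory\<close>, by digraphs with a symmetric
  arc relation; see the lemma \<open>graph_triangular_lattice\<close>.
\<close>

definition triangular_lattice :: "nat \<Rightarrow> (int \<times> int) pair_pre_digraph" where
  "triangular_lattice n =
     (let V = {1..int n} \<times> {1..int n}
      in \<lparr> pverts = V,
           parcs = {(u, v). u \<in> V \<and> v \<in> V \<and> (tri_step u v \<or> tri_step v u)} \<rparr>)"

text \<open>
  In a symmetric digraph the strongly connected components are the connected components of the
  underlying undirected graph.
\<close>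

definition num_components :: "('a, 'b) pre_digraph \<Rightarrow> nat" where
  "num_components G = card (pre_digraph.sccs G)"

text \<open>
  A site configuration assigns \<open>True\<close> to the open vertices and \<open>False\<close> to the closed ones.
  \<^const>\<open>Pi_pmf\<close> makes sense for graphs with finitely many vertices only.
\<close>

definition site_percolation :: "('a, 'b) pre_digraph \<Rightarrow> real \<Rightarrow> ('a \<Rightarrow> bool) pmf" where
  "site_percolation G p = Pi_pmf (verts G) False (\<lambda>_. bernoulli_pmf p)"

definition open_subgraph :: "('a, 'b) pre_digraph \<Rightarrow> ('a \<Rightarrow> bool) \<Rightarrow> ('a, 'b) pre_digraph" where
  "open_subgraph G \<omega> = G \<restriction> {v \<in> verts G. \<omega> v}"

definition expected_components :: "('a, 'b) pre_digraph \<Rightarrow> real \<Rightarrow> real" where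
  "expected_components G p =
     measure_pmf.expectation (site_percolation G p)
       (\<lambda>\<omega>. real (num_components (open_subgraph G \<omega>)))"

lemma graph_triangular_lattice: "graph (with_proj (triangular_lattice n))"
proof -
  let ?V = "{1..int n} \<times> {1..int n}"
  have "parcs (triangular_lattice n) \<subseteq> ?V \<times> ?V"
    by (auto simp: triangular_lattice_def Let_def)
  then have "finite (parcs (triangular_lattice n))"
    by (rule finite_subset) simp
  then show ?thesis
    by unfold_locales
      (auto simp: triangular_lattice_def Let_def tri_step_def symmetric_def sym_def arc_to_ends_def)
qed

lemma card_verts_triangular_lattice: "card (verts (with_proj (triangular_lattice n))) = n\<^sup>2"
  by (simp add: triangular_lattice_def Let_def power2_eq_square)

text \<open>
  The next two lemmas ensure that the expectations are bounded by the number of vertices, so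
  that their supremum over \<open>p\<close> is a genuine least upper bound.
\<close>

lemma (in wf_digraph) num_components_open_le:
  assumes "finite (verts G)"
  shows "num_components (open_subgraph G \<omega>) \<le> card (verts G)"
proof -
  define H where "H = open_subgraph G \<omega>"
  interpret H: wf_digraph H
    unfolding H_def open_subgraph_def by auto
  have VH: "verts H \<subseteq> verts G"
    by (auto simp: H_def open_subgraph_def)
  define f where "f S = (SOME v. v \<in> S)" for S :: "'a set"
  have f: "f S \<in> S" if "S \<in> H.sccs_verts" for S
    using that unfolding f_def H.in_sccs_verts_conv_reachable by (metis ex_in_conv someI_ex)
  have "inj_on f H.sccs_verts"
    by (rule inj_onI) (metis f H.sccs_verts_disjoint disjoint_iff)
  moreover have "f ` H.sccs_verts \<subseteq> verts G"
  proof
    fix v assume "v \<in> f ` H.sccs_verts"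
    then obtain S where S: "S \<in> H.sccs_verts" "v = f S" by auto
    then obtain c where "c \<in> H.sccs" "S = verts c"
      unfolding H.sccs_verts_conv by auto
    then show "v \<in> verts G"
      using f[OF S(1)] S(2) VH H.in_sccs_imp_induced[of c]
      by (auto simp: induced_subgraph_def subgraph_def)
  qed
  ultimately have "card H.sccs_verts \<le> card (verts G)"
    using assms by (metis card_inj_on_le)
  then show ?thesis
    unfolding num_components_def H_def[symmetric] H.card_sccs_verts .
qed

lemma bdd_above_expected_components:
  assumes "wf_digraph G" "finite (verts G)"
  shows "bdd_above (range (expected_components G))"
proof (rule bdd_aboveI2)
  fix p
  have "expected_components G p \<le>
      measure_pmf.expectation (site_percolation G p) (\<lambda>_. real (card (verts G)))"
    unfolding expected_components_def
    by (intro integral_mono measure_pmf.integrable_const_bound[where B = "real (card (verts G))"])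
      (auto simp: wf_digraph.num_components_open_le[OF assms])
  then show "expected_components G p \<le> real (card (verts G))"
    by simp
qed

end

theory Submission
  imports Defs
begin

text \<open>
  Insert the open vertices one by one in lexicographic order. A new vertex \<open>(i, j)\<close> changes the
  number of components by \<open>1 - d\<close>, where \<open>d\<close> counts the components met by its three earlier
  neighbours \<open>a = (i, j - 1)\<close>, \<open>b = (i - 1, j)\<close> and \<open>c = (i - 1, j + 1)\<close>, which form a path
  \<open>a - b - c\<close>. Bounding \<open>d\<close> by local data gives two local functionals of the configuration.

  Upper bound: \<open>d \<ge> 1\<close> if an earlier neighbour is open, and \<open>d = 2\<close> if \<open>a\<close> and \<open>c\<close> are open, \<open>b\<close> is
  closed, and \<open>a\<close> has no open neighbour so far. Hence the density is at most
  \<open>p (1 - p)^3 - p^3 (1 - p)^3\<close>.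

  Lower bound: \<open>d\<close> is at most the number of open runs of the path \<open>a - b - c\<close>, and it drops to \<open>1\<close>
  if \<open>b\<close> is closed but all its neighbours are open, as \<open>a\<close> and \<open>c\<close> are then connected around \<open>b\<close>.
  Hence the density is at least \<open>p - 3 p^2 + 2 p^3 + p^6 (1 - p)\<close>, which is evaluated at
  \<open>p = 53/250\<close>.

  The limit exists because the number of components is subadditive under cutting a large
  parallelogram into translates of a small one.
\<close>

subsection \<open>Components of induced subgraphs\<close>

text \<open>Components are taken of a vertex set \<open>S\<close> inside a fixed relation
  \<open>R\<close>, so inserting a vertex or cutting into pieces changes only
  \<open>S\<close>.\<close>

definition comp_of :: "'a rel \<Rightarrow> 'a set \<Rightarrow> 'a \<Rightarrow> 'a set" where
  "comp_of R S x = rtrancl_on S R `` {x}"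

definition comps :: "'a rel \<Rightarrow> 'a set \<Rightarrow> 'a set set" where
  "comps R S = comp_of R S ` S"

lemma comp_of_refl: "x \<in> S \<Longrightarrow> x \<in> comp_of R S x"
  by (simp add: comp_of_def)

lemma comp_of_subset: "comp_of R S x \<subseteq> S"
  by (auto simp: comp_of_def dest: in_rtrancl_on_in_F)

lemma comp_of_step: "y \<in> comp_of R S x \<Longrightarrow> (y, z) \<in> R \<Longrightarrow> z \<in> S \<Longrightarrow> z \<in> comp_of R S x"
  by (auto simp: comp_of_def intro: rtrancl_on_into_rtrancl_on)

lemma comp_of_trans: "y \<in> comp_of R S x \<Longrightarrow> z \<in> comp_of R S y \<Longrightarrow> z \<in> comp_of R S x"
  by (auto simp: comp_of_def intro: rtrancl_on_trans)

lemma comp_of_sym: "sym R \<Longrightarrow> y \<in> comp_of R S x \<Longrightarrow> x \<in> comp_of R S y"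
  by (auto simp: comp_of_def dest: rtrancl_on_sym symD)

lemma comp_of_eq: "sym R \<Longrightarrow> y \<in> comp_of R S x \<Longrightarrow> comp_of R S y = comp_of R S x"
  by (meson comp_of_sym comp_of_trans subsetI subset_antisym)

lemma comp_of_eq_edge:
  "sym R \<Longrightarrow> (x, y) \<in> R \<Longrightarrow> x \<in> S \<Longrightarrow> y \<in> S \<Longrightarrow> comp_of R S x = comp_of R S y"
  by (metis comp_of_eq comp_of_refl comp_of_step)

lemma comp_of_subset_closed:
  assumes "x \<in> Y" "\<And>y z. y \<in> Y \<Longrightarrow> z \<in> S \<Longrightarrow> (y, z) \<in> R \<Longrightarrow> z \<in> Y"
  shows "comp_of R S x \<subseteq> Y"
proof
  fix y assume "y \<in> comp_of R S x"
  then have "(x, y) \<in> rtrancl_on S R" by (simp add: comp_of_def)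
  then show "y \<in> Y" by (induction rule: rtrancl_on_induct) (use assms in auto)
qed

lemma comp_of_mono: "S \<subseteq> T \<Longrightarrow> comp_of R S x \<subseteq> comp_of R T x"
proof -
  assume "S \<subseteq> T"
  have "(x, y) \<in> rtrancl_on T R" if "(x, y) \<in> rtrancl_on S R" for y
    using that by (induction rule: rtrancl_on_induct) (use \<open>S \<subseteq> T\<close> in \<open>auto intro: rtrancl_on_into_rtrancl_on\<close>)
  then show ?thesis by (auto simp: comp_of_def)
qed

lemma finite_comps [simp]: "finite S \<Longrightarrow> finite (comps R S)"
  by (simp add: comps_def)

lemma comps_empty [simp]: "comps R {} = {}"
  by (simp add: comps_def)

lemma card_comps_le: "finite S \<Longrightarrow> card (comps R S) \<le> card S"
  by (simp add: comps_def card_image_le)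

text \<open>Enlarging the vertex set may merge components but never splits one, so every component
  of \<open>S \<union> T\<close> contains a component of \<open>S\<close> or of
  \<open>T\<close>.\<close>

lemma card_comps_Un_le:
  assumes "sym R" "finite S" "finite T"
  shows "card (comps R (S \<union> T)) \<le> card (comps R S) + card (comps R T)"
proof -
  \<comment> \<open>All members of a component \<open>X\<close> of either part have the same
    component in \<open>S \<union> T\<close>, and \<open>?f X\<close> is that component.\<close>
  let ?f = "\<lambda>X. \<Union> (comp_of R (S \<union> T) ` X)"
  have f: "comp_of R (S \<union> T) x = ?f (comp_of R A x)" if "x \<in> A" "A = S \<or> A = T" for x A
  proof -
    have "A \<subseteq> S \<union> T" using that by auto
    then have "comp_of R (S \<union> T) y = comp_of R (S \<union> T) x" if "y \<in> comp_of R A x" for y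
      using comp_of_mono[of A "S \<union> T" R x] comp_of_eq[OF assms(1)] that by blast
    then show ?thesis using comp_of_refl[OF \<open>x \<in> A\<close>, of R] by blast
  qed
  have "comps R (S \<union> T) \<subseteq> ?f ` (comps R S \<union> comps R T)"
  proof
    fix X assume "X \<in> comps R (S \<union> T)"
    then obtain x A where x: "x \<in> A" "A = S \<or> A = T" "X = comp_of R (S \<union> T) x"
      by (auto simp: comps_def)
    then have "comp_of R A x \<in> comps R S \<union> comps R T" by (auto simp: comps_def)
    then show "X \<in> ?f ` (comps R S \<union> comps R T)" using f[OF x(1,2)] x(3) by blast
  qed
  then have "card (comps R (S \<union> T)) \<le> card (comps R S \<union> comps R T)"
    using assms by (meson finite_UnI finite_comps finite_imageI card_mono card_image_le order.trans)
  also have "\<dots> \<le> card (comps R S) + card (comps R T)" by (rule card_Un_le)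
  finally show ?thesis .
qed

lemma card_comps_UN_le:
  assumes "sym R" "finite I" "\<And>i. i \<in> I \<Longrightarrow> finite (S i)"
  shows "card (comps R (\<Union>i\<in>I. S i)) \<le> (\<Sum>i\<in>I. card (comps R (S i)))"
  using assms(2,3)
proof (induction I rule: finite_induct)
  case (insert i I)
  then have "card (comps R (S i \<union> (\<Union>i\<in>I. S i))) \<le> card (comps R (S i)) + card (comps R (\<Union>i\<in>I. S i))"
    by (intro card_comps_Un_le assms(1)) auto
  with insert show ?case by fastforce
qed auto

lemma card_comps_image:
  assumes "inj h" "\<And>x y. (h x, h y) \<in> R \<longleftrightarrow> (x, y) \<in> R"
  shows "card (comps R (h ` S)) = card (comps R S)"
proof -
  have *: "comp_of R (h ` S) (h x) = h ` comp_of R S x" if "x \<in> S" for x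
  proof
    show "comp_of R (h ` S) (h x) \<subseteq> h ` comp_of R S x"
      by (rule comp_of_subset_closed) (use that assms in \<open>auto simp: comp_of_refl comp_of_step\<close>)
    have "comp_of R S x \<subseteq> h -` comp_of R (h ` S) (h x)"
      by (rule comp_of_subset_closed) (use that assms in \<open>auto simp: comp_of_refl intro: comp_of_step\<close>)
    then show "h ` comp_of R S x \<subseteq> comp_of R (h ` S) (h x)" by auto
  qed
  have "comps R (h ` S) = (`) h ` comps R S"
    unfolding comps_def image_image using * by (intro image_cong) auto
  moreover have "inj_on ((`) h) (comps R S)"
    using assms(1) by (meson inj_image_eq_iff inj_onI)
  ultimately show ?thesis by (simp add: card_image)
qed

text \<open>The components met by the neighbours of \<open>v\<close> fuse with \<open>v\<close> into
  one, and all others stay as they are. The additive form avoids truncated subtraction.\<close>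

lemma card_comps_insert:
  assumes "sym R" "finite S" "v \<notin> S"
  shows "card (comps R (insert v S)) + card (comp_of R S ` {x \<in> S. (v, x) \<in> R}) = card (comps R S) + 1"
proof -
  define K where "K = comp_of R S ` {x \<in> S. (v, x) \<in> R}"
  define M where "M = insert v (\<Union>K)"
  have K: "K \<subseteq> comps R S" by (auto simp: K_def comps_def)
  have v: "comp_of R (insert v S) v = M"
  proof
    show "comp_of R (insert v S) v \<subseteq> M"
    proof (rule comp_of_subset_closed)
      fix y z assume "y \<in> M" "z \<in> insert v S" "(y, z) \<in> R"
      then show "z \<in> M" unfolding M_def K_def
        by (auto intro: comp_of_refl comp_of_step)
    qed (simp add: M_def)
    have "y \<in> comp_of R (insert v S) v" if "(v, x) \<in> R" "x \<in> S" "y \<in> comp_of R S x" for x y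
    proof (rule comp_of_trans)
      show "x \<in> comp_of R (insert v S) v" using that by (intro comp_of_step[OF comp_of_refl]) auto
      show "y \<in> comp_of R (insert v S) x" using that comp_of_mono[of S "insert v S" R x] by blast
    qed
    then show "M \<subseteq> comp_of R (insert v S) v" by (auto simp: M_def K_def comp_of_refl)
  qed
  have in_K: "comp_of R (insert v S) x = M" if "x \<in> S" "comp_of R S x \<in> K" for x
  proof -
    have "x \<in> M" using that comp_of_refl[of x S R] by (auto simp: M_def)
    then show ?thesis using v comp_of_eq[OF assms(1)] by metis
  qed
  have notin_K: "comp_of R (insert v S) x = comp_of R S x" if "x \<in> S" "comp_of R S x \<notin> K" for x
  proof
    show "comp_of R (insert v S) x \<subseteq> comp_of R S x"
    proof (rule comp_of_subset_closed)
      fix y z assume yz: "y \<in> comp_of R S x" "z \<in> insert v S" "(y, z) \<in> R"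
      have "z \<noteq> v"
      proof
        assume "z = v"
        then have "(v, y) \<in> R" using yz assms(1) by (auto dest: symD)
        moreover have "y \<in> S" "comp_of R S y = comp_of R S x"
          using yz(1) comp_of_subset[of R S x] comp_of_eq[OF assms(1)] by auto
        ultimately have "comp_of R S x \<in> K" unfolding K_def by (metis (mono_tags, lifting) image_eqI mem_Collect_eq)
        then show False using that by simp
      qed
      then show "z \<in> comp_of R S x" using yz by (auto intro: comp_of_step)
    qed (use that in \<open>simp add: comp_of_refl\<close>)
  qed (rule comp_of_mono, auto)
  have "comps R (insert v S) = insert M (comps R S - K)"
  proof
    show "comps R (insert v S) \<subseteq> insert M (comps R S - K)"
    proof
      fix X assume "X \<in> comps R (insert v S)"
      then consider "X = M" | x where "x \<in> S" "X = comp_of R (insert v S) x"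
        using v by (auto simp: comps_def)
      then show "X \<in> insert M (comps R S - K)"
      proof cases
        case 2
        then show ?thesis using in_K notin_K by (cases "comp_of R S x \<in> K") (auto simp: comps_def)
      qed simp
    qed
    show "insert M (comps R S - K) \<subseteq> comps R (insert v S)"
    proof
      fix X assume "X \<in> insert M (comps R S - K)"
      then consider "X = M" | x where "x \<in> S" "X = comp_of R S x" "X \<notin> K"
        by (auto simp: comps_def)
      then show "X \<in> comps R (insert v S)"
      proof cases
        case 1
        then show ?thesis using v by (simp add: comps_def)
      next
        case 2
        then have "X = comp_of R (insert v S) x" using notin_K by simp
        then show ?thesis using 2 by (simp add: comps_def)
      qed
    qed
  qed
  moreover have "M \<notin> comps R S"
    using comp_of_subset[of R S] assms(3) by (auto simp: comps_def M_def)
  ultimately have "card (comps R (insert v S)) = card (comps R S - K) + 1"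
    using assms(2) by simp
  moreover have "card (comps R S - K) + card K = card (comps R S)"
    using K assms(2) by (metis card_Diff_subset card_mono finite_comps finite_subset le_add_diff_inverse2)
  ultimately show ?thesis by (simp add: K_def)
qed

section \<open>The triangular lattice as a relation on the integer plane\<close>

definition tri_adj :: "(int \<times> int) rel" where
  "tri_adj = {(u, v). tri_step u v \<or> tri_step v u}"

lemma sym_tri_adj: "sym tri_adj"
  by (auto simp: tri_adj_def sym_def)

text \<open>Adjacency is symmetric, so strong components are reachability classes, and
  \<open>rtrancl_on S\<close> confines paths to \<open>S\<close> just as the arcs of the induced
  subgraph do.\<close>

lemma num_components_open_subgraph:
  "num_components (open_subgraph (with_proj (triangular_lattice n)) \<omega>) =
     card (comps tri_adj {v \<in> {1..int n} \<times> {1..int n}. \<omega> v})"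
proof -
  define V where "V = {1..int n} \<times> {1..int n}"
  define S where "S = {v \<in> V. \<omega> v}"
  define H where "H = open_subgraph (with_proj (triangular_lattice n)) \<omega>"
  interpret G: graph "with_proj (triangular_lattice n)" by (rule graph_triangular_lattice)
  interpret H: wf_digraph H unfolding H_def open_subgraph_def by auto
  have verts: "verts H = S"
    by (auto simp: H_def open_subgraph_def S_def V_def triangular_lattice_def Let_def)
  have ends: "arcs_ends H = tri_adj \<inter> S \<times> S"
    by (auto simp: H_def open_subgraph_def induce_subgraph_def arcs_ends_def arc_to_ends_def S_def V_def
        triangular_lattice_def Let_def tri_adj_def image_iff)
  have "rtrancl_on S (tri_adj \<inter> S \<times> S) = rtrancl_on S tri_adj"
  proof (intro set_eqI iffI; clarify)
    fix x y
    show "(x, y) \<in> rtrancl_on S tri_adj" if "(x, y) \<in> rtrancl_on S (tri_adj \<inter> S \<times> S)"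
      using that by (induction rule: rtrancl_on_induct) (auto intro: rtrancl_on_into_rtrancl_on)
    show "(x, y) \<in> rtrancl_on S (tri_adj \<inter> S \<times> S)" if "(x, y) \<in> rtrancl_on S tri_adj"
      using that by (induction rule: rtrancl_on_induct) (auto intro: rtrancl_on_into_rtrancl_on)
  qed
  then have "H.scc_of u = comp_of tri_adj S u" for u
    unfolding H.scc_of_def comp_of_def reachable_def verts ends
    using rtrancl_on_sym[OF sym_tri_adj, of S] by (auto dest: symD)
  then have "H.sccs_verts = comps tri_adj S"
    unfolding H.sccs_verts_conv_scc_of comps_def verts by simp
  then show ?thesis
    unfolding num_components_def H_def[symmetric] H.card_sccs_verts[symmetric] S_def V_def by simp
qed

subsection \<open>Local bounds on the number of components\<close>

text \<open>The lexicographic maximum is split off. In this order a new vertex can have only three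
  neighbours among the old ones, since its other three neighbours are later.\<close>

lemma finite_lex_induct [consumes 1, case_names empty insert]:
  fixes S :: "(int \<times> int) set"
  assumes "finite S" "P {}"
    and "\<And>i j S. finite S \<Longrightarrow> (\<And>k l. (k, l) \<in> S \<Longrightarrow> k < i \<or> k = i \<and> l < j) \<Longrightarrow> P S
      \<Longrightarrow> P (insert (i, j) S)"
  shows "P S"
  using assms(1)
proof (induction S rule: finite_psubset_induct)
  case (psubset S)
  show ?case
  proof (cases "S = {}")
    case False
    define i where "i = Max (fst ` S)"
    define j where "j = Max (snd ` {x \<in> S. fst x = i})"
    have fin: "finite (fst ` S)" "finite (snd ` {x \<in> S. fst x = i})" using psubset by auto
    have "i \<in> fst ` S" unfolding i_def using fin False by (intro Max_in) auto
    then have "j \<in> snd ` {x \<in> S. fst x = i}" unfolding j_def using fin by (intro Max_in) auto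
    then have ij: "(i, j) \<in> S" by auto
    have "k < i \<or> k = i \<and> l < j" if kl: "(k, l) \<in> S - {(i, j)}" for k l
    proof -
      have "k \<in> fst ` S" using kl by (auto intro: rev_image_eqI)
      then have "k \<le> i" unfolding i_def by (rule Max_ge[OF fin(1)])
      moreover have "l \<le> j" if "k = i"
      proof -
        have "l \<in> snd ` {x \<in> S. fst x = i}" using kl that by (auto intro: rev_image_eqI)
        then show ?thesis unfolding j_def by (rule Max_ge[OF fin(2)])
      qed
      ultimately show ?thesis using kl by auto
    qed
    then have "P (insert (i, j) (S - {(i, j)}))"
      using psubset.IH[of "S - {(i, j)}"] psubset.hyps ij by (intro assms(3)) auto
    then show ?thesis using ij by (simp add: insert_absorb)
  qed (use assms(2) in simp)
qed

section \<open>Cylinder indicators and local weights\<close>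

definition cyl :: "'a set \<Rightarrow> 'a set \<Rightarrow> 'a set \<Rightarrow> real" where
  "cyl A B S = of_bool (A \<subseteq> S \<and> B \<inter> S = {})"

lemma cyl_insert: "v \<notin> A \<Longrightarrow> v \<notin> B \<Longrightarrow> cyl A B (insert v S) = cyl A B S"
  by (simp add: cyl_def subset_insert)

text \<open>The sites \<open>(i, j - 2)\<close> and \<open>(i - 1, j - 1)\<close> are the earlier
  neighbours of \<open>a\<close> other than \<open>b\<close>. The first cylinder alone would give
  \<open>p (1 - p)^3\<close>, whose maximum \<open>27/256\<close> exceeds
  \<open>0.10107\<close>.\<close>

definition upper_weight :: "int \<times> int \<Rightarrow> (int \<times> int) set \<Rightarrow> real" where
  "upper_weight = (\<lambda>(i, j) S.
     cyl {(i, j)} {(i, j - 1), (i - 1, j), (i - 1, j + 1)} S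
     - cyl {(i, j), (i, j - 1), (i - 1, j + 1)} {(i - 1, j), (i, j - 2), (i - 1, j - 1)} S)"

text \<open>The number of open runs of a path is the number of its open vertices minus the number of
  its edges with both ends open. The last cylinder opens all six neighbours of the closed vertex
  \<open>b\<close>.\<close>

definition lower_weight :: "int \<times> int \<Rightarrow> (int \<times> int) set \<Rightarrow> real" where
  "lower_weight = (\<lambda>(i, j) S.
     cyl {(i, j)} {} S
     - cyl {(i, j), (i, j - 1)} {} S - cyl {(i, j), (i - 1, j)} {} S - cyl {(i, j), (i - 1, j + 1)} {} S
     + cyl {(i, j), (i, j - 1), (i - 1, j)} {} S + cyl {(i, j), (i - 1, j), (i - 1, j + 1)} {} S
     + cyl {(i, j), (i, j - 1), (i - 1, j + 1), (i - 1, j - 1), (i - 2, j), (i - 2, j + 1)} {(i - 1, j)} S)"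

context
  fixes S :: "(int \<times> int) set" and i j :: int
  assumes fin: "finite S" and lex: "\<And>k l. (k, l) \<in> S \<Longrightarrow> k < i \<or> k = i \<and> l < j"
begin

lemma last_notin: "(i, j) \<notin> S"
  using lex by blast

lemma neighbours_of_last:
  "{x \<in> S. ((i, j), x) \<in> tri_adj} = {(i, j - 1), (i - 1, j), (i - 1, j + 1)} \<inter> S"
proof (intro set_eqI iffI)
  fix x assume "x \<in> {x \<in> S. ((i, j), x) \<in> tri_adj}"
  then show "x \<in> {(i, j - 1), (i - 1, j), (i - 1, j + 1)} \<inter> S"
    using lex[of "fst x" "snd x"] by (cases x) (auto simp: tri_adj_def tri_step_def)
qed (auto simp: tri_adj_def tri_step_def)

text \<open>The weight at \<open>x\<close> looks only at \<open>x\<close> and lexicographically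
  earlier vertices, so later insertions leave it alone.\<close>

lemma upper_weight_insert:
  assumes "x \<in> S" shows "upper_weight x (insert (i, j) S) = upper_weight x S"
proof -
  obtain k l where x: "x = (k, l)" by (cases x)
  then have "k < i \<or> k = i \<and> l < j" using lex assms by blast
  then show ?thesis unfolding x upper_weight_def prod.case
    by (intro arg_cong2[where f = "(-)"] cyl_insert) auto
qed

lemma lower_weight_insert:
  assumes "x \<in> S" shows "lower_weight x (insert (i, j) S) = lower_weight x S"
proof -
  obtain k l where x: "x = (k, l)" by (cases x)
  then have "k < i \<or> k = i \<and> l < j" using lex assms by blast
  then show ?thesis unfolding x lower_weight_def prod.case
    by (intro arg_cong2[where f = "(+)"] arg_cong2[where f = "(-)"] cyl_insert) auto
qed

lemma adjacent_components_ge: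
  "1 - upper_weight (i, j) (insert (i, j) S)
    \<le> real (card (comp_of tri_adj S ` ({(i, j - 1), (i - 1, j), (i - 1, j + 1)} \<inter> S)))"
proof -
  let ?a = "(i, j - 1)" and ?b = "(i - 1, j)" and ?c = "(i - 1, j + 1)"
  let ?d = "(i, j - 2)" and ?e = "(i - 1, j - 1)"
  let ?C = "comp_of tri_adj S"
  have w: "upper_weight (i, j) (insert (i, j) S) = of_bool (?a \<notin> S \<and> ?b \<notin> S \<and> ?c \<notin> S)
      - of_bool (?a \<in> S \<and> ?c \<in> S \<and> ?b \<notin> S \<and> ?d \<notin> S \<and> ?e \<notin> S)"
    by (simp add: upper_weight_def cyl_def)
  consider (none) "?a \<notin> S \<and> ?b \<notin> S \<and> ?c \<notin> S"
    | (two) "?a \<in> S \<and> ?c \<in> S \<and> ?b \<notin> S \<and> ?d \<notin> S \<and> ?e \<notin> S"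
    | (one) "?a \<in> S \<or> ?b \<in> S \<or> ?c \<in> S" "\<not> (?a \<in> S \<and> ?c \<in> S \<and> ?b \<notin> S \<and> ?d \<notin> S \<and> ?e \<notin> S)"
    by blast
  then show ?thesis
  proof cases
    case none
    then show ?thesis unfolding w by simp
  next
    case two
    \<comment> \<open>The six neighbours of \<open>a\<close> are \<open>b\<close>, \<open>d\<close>,
      \<open>e\<close>, the new vertex \<open>(i, j)\<close> and two later vertices with first
      coordinate \<open>i + 1\<close>. None lies in \<open>S\<close>, so \<open>a\<close> is
      isolated there.\<close>
    have "?C ?a \<subseteq> {?a}"
    proof (rule comp_of_subset_closed)
      fix y z assume "y \<in> {?a}" "z \<in> S" "(y, z) \<in> tri_adj"
      moreover obtain k l where "z = (k, l)" by (cases z)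
      ultimately have "(?a, (k, l)) \<in> tri_adj" "(k, l) \<in> S" "z = (k, l)" by auto
      moreover have "(k, l) \<noteq> (i, j)" "k < i \<or> k = i \<and> l < j" using \<open>(k, l) \<in> S\<close> lex by blast+
      moreover have "(k, l) \<noteq> ?b" "(k, l) \<noteq> ?d" "(k, l) \<noteq> ?e" using \<open>(k, l) \<in> S\<close> two by metis+
      ultimately show "z \<in> {?a}" by (auto simp: tri_adj_def tri_step_def)
    qed simp
    moreover have "?c \<in> ?C ?c" using two by (simp add: comp_of_refl)
    moreover have "?c \<noteq> ?a" by simp
    ultimately have "?C ?a \<noteq> ?C ?c" by blast
    then have "2 = card {?C ?a, ?C ?c}" by simp
    also have "\<dots> \<le> card (?C ` ({?a, ?b, ?c} \<inter> S))" using two fin by (intro card_mono) auto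
    finally show ?thesis using two unfolding w by simp
  next
    case one
    then have "{?a, ?b, ?c} \<inter> S \<noteq> {}" by blast
    then have "card (?C ` ({?a, ?b, ?c} \<inter> S)) > 0" using fin by (simp add: card_gt_0_iff)
    moreover have "upper_weight (i, j) (insert (i, j) S) = 0" unfolding w using one by (simp only: of_bool_def) simp
    ultimately show ?thesis by simp
  qed
qed

lemma adjacent_components_le:
  "real (card (comp_of tri_adj S ` ({(i, j - 1), (i - 1, j), (i - 1, j + 1)} \<inter> S)))
    \<le> 1 - lower_weight (i, j) (insert (i, j) S)"
proof -
  let ?a = "(i, j - 1)" and ?b = "(i - 1, j)" and ?c = "(i - 1, j + 1)"
  let ?e = "(i - 1, j - 1)" and ?f = "(i - 2, j)" and ?g = "(i - 2, j + 1)"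
  let ?C = "comp_of tri_adj S"
  have adj: "(?a, ?b) \<in> tri_adj" "(?b, ?c) \<in> tri_adj" "(?a, ?e) \<in> tri_adj"
    "(?e, ?f) \<in> tri_adj" "(?f, ?g) \<in> tri_adj" "(?g, ?c) \<in> tri_adj"
    by (auto simp: tri_adj_def tri_step_def)
  note eq = comp_of_eq_edge[OF sym_tri_adj, where S = S]
  have ab: "?C ?a = ?C ?b" if "?a \<in> S" "?b \<in> S" using eq[OF adj(1)] that by simp
  have bc: "?C ?b = ?C ?c" if "?b \<in> S" "?c \<in> S" using eq[OF adj(2)] that by simp
  \<comment> \<open>The path \<open>a - e - f - g - c\<close> runs around \<open>b\<close> through
    its neighbours other than \<open>(i, j)\<close>.\<close>
  have ac: "?C ?a = ?C ?c" if "?a \<in> S" "?e \<in> S" "?f \<in> S" "?g \<in> S" "?c \<in> S"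
    using eq[OF adj(3)] eq[OF adj(4)] eq[OF adj(5)] eq[OF adj(6)] that by simp
  have le: "card (?C ` ({?a, ?b, ?c} \<inter> S)) \<le> card X" if "?C ` ({?a, ?b, ?c} \<inter> S) \<subseteq> X" "finite X" for X
    using that by (rule card_mono[rotated])
  have w: "lower_weight (i, j) (insert (i, j) S) =
      1 - of_bool (?a \<in> S) - of_bool (?b \<in> S) - of_bool (?c \<in> S)
      + of_bool (?a \<in> S \<and> ?b \<in> S) + of_bool (?b \<in> S \<and> ?c \<in> S)
      + of_bool (?a \<in> S \<and> ?c \<in> S \<and> ?e \<in> S \<and> ?f \<in> S \<and> ?g \<in> S \<and> ?b \<notin> S)"
    by (simp add: lower_weight_def cyl_def)
  consider (b) "?b \<in> S" | (both) "?b \<notin> S" "?a \<in> S" "?c \<in> S"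
    | (a) "?b \<notin> S" "?a \<in> S" "?c \<notin> S" | (c) "?b \<notin> S" "?a \<notin> S" "?c \<in> S"
    | (none) "?b \<notin> S" "?a \<notin> S" "?c \<notin> S"
    by blast
  then show ?thesis
  proof cases
    case b
    then show ?thesis using le[of "{?C ?b}"] ab bc unfolding w by (cases "?a \<in> S"; cases "?c \<in> S"; simp)
  next
    case both
    show ?thesis
    proof (cases "?e \<in> S \<and> ?f \<in> S \<and> ?g \<in> S")
      case True
      then show ?thesis using le[of "{?C ?a}"] both ac
        unfolding w by simp
    next
      case False
      have "card {?C ?a, ?C ?c} \<le> 2" by (simp add: card_insert_if)
      then show ?thesis using le[of "{?C ?a, ?C ?c}"] both False unfolding w by auto
    qed
  next
    case a
    then show ?thesis using le[of "{?C ?a}"] unfolding w by simp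
  next
    case c
    then show ?thesis using le[of "{?C ?c}"] unfolding w by simp
  next
    case none
    then show ?thesis unfolding w by simp
  qed
qed

lemma card_comps_insert_last:
  "real (card (comps tri_adj (insert (i, j) S)))
     + real (card (comp_of tri_adj S ` ({(i, j - 1), (i - 1, j), (i - 1, j + 1)} \<inter> S)))
   = real (card (comps tri_adj S)) + 1"
  using card_comps_insert[OF sym_tri_adj fin last_notin] unfolding neighbours_of_last
  by (metis of_nat_1 of_nat_add)

end

text \<open>The increments \<open>1 - d\<close> telescope along the insertion order; each is at most
  the weight of the new vertex, and the old weights do not change.\<close>

lemma card_comps_le_upper_weight:
  "finite S \<Longrightarrow> real (card (comps tri_adj S)) \<le> (\<Sum>x\<in>S. upper_weight x S)"
proof (induction S rule: finite_lex_induct)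
  case (insert i j S)
  have "(\<Sum>x\<in>insert (i, j) S. upper_weight x (insert (i, j) S))
      = upper_weight (i, j) (insert (i, j) S) + (\<Sum>x\<in>S. upper_weight x S)"
    using insert(1) last_notin[OF insert(1,2)] upper_weight_insert[OF insert(1,2)] by simp
  with insert(3) card_comps_insert_last[OF insert(1,2)] adjacent_components_ge[OF insert(1,2)]
  show ?case by linarith
qed simp

lemma card_comps_ge_lower_weight:
  "finite S \<Longrightarrow> (\<Sum>x\<in>S. lower_weight x S) \<le> real (card (comps tri_adj S))"
proof (induction S rule: finite_lex_induct)
  case (insert i j S)
  have "(\<Sum>x\<in>insert (i, j) S. lower_weight x (insert (i, j) S))
      = lower_weight (i, j) (insert (i, j) S) + (\<Sum>x\<in>S. lower_weight x S)"
    using insert(1) last_notin[OF insert(1,2)] lower_weight_insert[OF insert(1,2)] by simp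
  with insert(3) card_comps_insert_last[OF insert(1,2)] adjacent_components_le[OF insert(1,2)]
  show ?case by linarith
qed simp

subsection \<open>Expectations of local functionals\<close>

text \<open>The functional takes the set of open vertices, so that combinatorial estimates for sets
  apply pointwise.\<close>

abbreviation open_expectation :: "'a set \<Rightarrow> real \<Rightarrow> ('a set \<Rightarrow> real) \<Rightarrow> real" where
  "open_expectation V p f \<equiv>
     measure_pmf.expectation (Pi_pmf V False (\<lambda>_. bernoulli_pmf p)) (\<lambda>\<omega>. f {x \<in> V. \<omega> x})"

lemma integrable_Pi_bernoulli [simp]:
  fixes f :: "('a \<Rightarrow> bool) \<Rightarrow> real"
  assumes "finite V"
  shows "integrable (measure_pmf (Pi_pmf V False (\<lambda>_. bernoulli_pmf p))) f"
proof (rule integrable_measure_pmf_finite)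
  show "finite (set_pmf (Pi_pmf V False (\<lambda>_. bernoulli_pmf p)))"
    by (rule finite_subset[OF set_Pi_pmf_subset'[OF assms]]) (use assms in auto)
qed

lemma open_expectation_subset:
  assumes "finite V" "W \<subseteq> V"
  shows "open_expectation V p (\<lambda>S. f (S \<inter> W)) = open_expectation W p f"
proof -
  have "{x \<in> V. \<omega> x} \<inter> W = {x \<in> W. \<omega> x}" for \<omega> using assms by auto
  \<comment> \<open>\<open>Pi_pmf_subset\<close> obtains the marginal on \<open>W\<close> by
    resetting the sites outside \<open>W\<close> to the default \<open>False\<close>.\<close>
  moreover have "{x \<in> W. if x \<in> W then \<omega> x else False} = {x \<in> W. \<omega> x}" for \<omega> by auto
  ultimately show ?thesis
    unfolding Pi_pmf_subset[OF assms] integral_map_pmf by simp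
qed

text \<open>Injectivity of \<open>h\<close> on the whole type sends sites outside \<open>V\<close>
  to sites outside the image, where configurations take the default \<open>False\<close>.\<close>

lemma open_expectation_bij:
  assumes "finite V" "bij h"
  shows "open_expectation (h ` V) p f = open_expectation V p (\<lambda>S. f (h ` S))"
proof -
  have "Pi_pmf V False (\<lambda>_. bernoulli_pmf p)
      = map_pmf (\<lambda>g. g \<circ> h) (Pi_pmf (h ` V) False (\<lambda>_. bernoulli_pmf p))"
    using assms by (intro Pi_pmf_bij_betw)
      (auto simp: bij_def intro!: inj_on_imp_bij_betw dest: inj_onD intro: inj_on_subset)
  moreover have "h ` {x \<in> V. g (h x)} = {x \<in> h ` V. g x}" for g by auto
  ultimately show ?thesis by simp
qed

lemma open_expectation_cyl:
  assumes V: "finite V" "A \<subseteq> V" "B \<subseteq> V" "A \<inter> B = {}" and p: "0 \<le> p" "p \<le> 1"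
  shows "open_expectation V p (cyl A B) = p ^ card A * (1 - p) ^ card B"
proof -
  \<comment> \<open>The factor at a site indicates that the site obeys its constraint, so
    independence turns the expectation into a product.\<close>
  define f :: "'a \<Rightarrow> bool \<Rightarrow> real" where
    "f x b = (if x \<in> A then of_bool b else 1) * (if x \<in> B then of_bool (\<not> b) else 1)" for x b
  have fin: "finite A" "finite B" using V by (auto intro: finite_subset)
  have f: "cyl A B {x \<in> V. \<omega> x} = (\<Prod>x\<in>V. f x (\<omega> x))" for \<omega>
  proof -
    have "(\<Prod>x\<in>V. f x (\<omega> x)) = of_bool (\<forall>x\<in>V. f x (\<omega> x) = 1)"
    proof (cases "\<forall>x\<in>V. f x (\<omega> x) = 1")
      case False
      then obtain x where "x \<in> V" "f x (\<omega> x) = 0" by (auto simp: f_def split: if_splits)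
      then show ?thesis using False V(1) by auto
    qed simp
    also have "(\<forall>x\<in>V. f x (\<omega> x) = 1) \<longleftrightarrow> A \<subseteq> {x \<in> V. \<omega> x} \<and> B \<inter> {x \<in> V. \<omega> x} = {}"
      using V by (auto simp: f_def split: if_splits)
    finally show ?thesis by (simp add: cyl_def)
  qed
  have "open_expectation V p (cyl A B) = (\<Prod>x\<in>V. measure_pmf.expectation (bernoulli_pmf p) (f x))"
    unfolding f using V(1)
    by (intro expectation_prod_Pi_pmf) (auto simp: f_def intro!: integrable_measure_pmf_finite)
  also have "\<dots> = (\<Prod>x\<in>V. (if x \<in> A then p else 1) * (if x \<in> B then 1 - p else 1))"
    using V p by (intro prod.cong refl) (auto simp: f_def)
  also have "\<dots> = p ^ card A * (1 - p) ^ card B"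
    using V fin by (simp add: prod.distrib prod.If_cases Int_absorb1)
  finally show ?thesis .
qed


section \<open>Boundary terms and density bounds at fixed \<open>p\<close>\<close>

definition grid :: "nat \<Rightarrow> (int \<times> int) set" where
  "grid n = {1..int n} \<times> {1..int n}"

lemma finite_grid [simp]: "finite (grid n)" and card_grid: "card (grid n) = n\<^sup>2"
  by (simp_all add: grid_def power2_eq_square)

abbreviation ncomps :: "(int \<times> int) set \<Rightarrow> real" where
  "ncomps S \<equiv> real (card (comps tri_adj S))"

lemma expected_components_triangular:
  "expected_components (with_proj (triangular_lattice n)) p = open_expectation (grid n) p ncomps"
  unfolding expected_components_def site_percolation_def num_components_open_subgraph grid_def
  by (simp add: triangular_lattice_def Let_def)

text \<open>At the points of \<open>inner n\<close>, the two weights refer to vertices of \<open>grid n\<close> only.\<close>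

definition inner :: "nat \<Rightarrow> (int \<times> int) set" where
  "inner n = {3..int n} \<times> {3..int n - 1}"

text \<open>The weights reach back two steps in each coordinate and forward one step in the second,
  which costs two lines in one direction and three in the other.\<close>

lemma card_grid_diff_inner: "card (grid n - inner n) \<le> 5 * n"
proof -
  have "grid n - inner n \<subseteq> {1, 2} \<times> {1..int n} \<union> {1..int n} \<times> {1, 2, int n}"
    by (auto simp: grid_def inner_def)
  then have "card (grid n - inner n) \<le> card ({1, 2} \<times> {1..int n} \<union> {1..int n} \<times> {1, 2, int n})"
    by (rule card_mono[rotated]) simp
  also have "\<dots> \<le> card ({1, 2 :: int} \<times> {1..int n}) + card ({1..int n} \<times> {1, 2, int n})"
    by (rule card_Un_le)
  also have "card {1, 2, int n} \<le> 3" by (simp add: card_insert_if)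
  then have "card ({1..int n} \<times> {1, 2, int n}) \<le> n * 3"
    unfolding card_cartesian_product by (intro mult_mono) auto
  then have "card ({1, 2 :: int} \<times> {1..int n}) + card ({1..int n} \<times> {1, 2, int n}) \<le> 5 * n"
    by (simp add: card_cartesian_product)
  finally show ?thesis .
qed

text \<open>Inner vertices contribute exactly \<open>q\<close>, and each of the at most
  \<open>5 * n\<close> others deviates from \<open>q\<close> by at most \<open>2 * c\<close>. By
  \<open>zero\<close>, the sum over the random set is a sum over the whole grid.\<close>

lemma open_expectation_local_sum:
  fixes w :: "int \<times> int \<Rightarrow> (int \<times> int) set \<Rightarrow> real"
  assumes zero: "\<And>x S. x \<notin> S \<Longrightarrow> w x S = 0"
    and bound: "\<And>x S. \<bar>w x S\<bar> \<le> c" "\<bar>q\<bar> \<le> c"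
    and inner: "\<And>x. x \<in> inner n \<Longrightarrow> open_expectation (grid n) p (w x) = q"
  shows "\<bar>open_expectation (grid n) p (\<lambda>S. \<Sum>x\<in>S. w x S) - q * (real n)\<^sup>2\<bar> \<le> 10 * c * real n"
proof -
  let ?E = "open_expectation (grid n) p"
  have c: "c \<ge> 0" using bound(2) by linarith
  have sub: "inner n \<subseteq> grid n" by (auto simp: inner_def grid_def)
  have "(\<Sum>x\<in>{x \<in> grid n. \<omega> x}. w x {x \<in> grid n. \<omega> x}) = (\<Sum>x\<in>grid n. w x {x \<in> grid n. \<omega> x})" for \<omega>
    by (rule sum.mono_neutral_left) (auto intro: zero)
  then have "?E (\<lambda>S. \<Sum>x\<in>S. w x S) = (\<Sum>x\<in>grid n. ?E (w x))" by simp
  also have "\<dots> - q * (real n)\<^sup>2 = (\<Sum>x\<in>grid n. ?E (w x) - q)"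
    by (simp add: sum_subtractf card_grid)
  also have "\<dots> = (\<Sum>x\<in>grid n - inner n. ?E (w x) - q)"
    using inner sub by (intro sum.mono_neutral_right) auto
  finally have "\<bar>?E (\<lambda>S. \<Sum>x\<in>S. w x S) - q * (real n)\<^sup>2\<bar> = \<bar>\<Sum>x\<in>grid n - inner n. ?E (w x) - q\<bar>"
    by simp
  also have "\<dots> \<le> (\<Sum>x\<in>grid n - inner n. \<bar>?E (w x) - q\<bar>)" by (rule sum_abs)
  also have "\<dots> \<le> (\<Sum>x\<in>grid n - inner n. 2 * c)"
  proof (rule sum_mono)
    fix x
    have "\<bar>?E (w x)\<bar>
        \<le> measure_pmf.expectation (Pi_pmf (grid n) False (\<lambda>_. bernoulli_pmf p)) (\<lambda>\<omega>. \<bar>w x {x \<in> grid n. \<omega> x}\<bar>)"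
      by (rule integral_abs_bound)
    also have "\<dots> \<le> measure_pmf.expectation (Pi_pmf (grid n) False (\<lambda>_. bernoulli_pmf p)) (\<lambda>\<omega>. c)"
      using bound(1) by (intro integral_mono) auto
    finally show "\<bar>?E (w x) - q\<bar> \<le> 2 * c" using bound(2) by simp
  qed
  also have "\<dots> = real (card (grid n - inner n)) * (2 * c)" by simp
  also have "\<dots> \<le> real (5 * n) * (2 * c)"
    using card_grid_diff_inner c by (intro mult_right_mono of_nat_mono) auto
  finally show ?thesis by (simp add: mult_ac)
qed

lemma cyl_nonneg: "0 \<le> cyl A B S" and cyl_le_1: "cyl A B S \<le> 1"
  by (simp_all add: cyl_def)

lemma open_expectation_upper_weight:
  assumes "x \<in> inner n" "0 \<le> p" "p \<le> 1"
  shows "open_expectation (grid n) p (upper_weight x) = p * (1 - p) ^ 3 - p ^ 3 * (1 - p) ^ 3"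
proof -
  obtain i j where x: "x = (i, j)" by (cases x)
  then have ij: "3 \<le> i" "i \<le> int n" "3 \<le> j" "j \<le> int n - 1" using assms(1) by (auto simp: inner_def)
  show ?thesis
    unfolding x upper_weight_def prod.case using assms(2,3) ij
    by (simp add: open_expectation_cyl grid_def power_numeral_reduce power2_eq_square)
qed

lemma open_expectation_lower_weight:
  assumes "x \<in> inner n" "0 \<le> p" "p \<le> 1"
  shows "open_expectation (grid n) p (lower_weight x) = p - 3 * p\<^sup>2 + 2 * p ^ 3 + p ^ 6 * (1 - p)"
proof -
  obtain i j where x: "x = (i, j)" by (cases x)
  then have ij: "3 \<le> i" "i \<le> int n" "3 \<le> j" "j \<le> int n - 1" using assms(1) by (auto simp: inner_def)
  show ?thesis
    unfolding x lower_weight_def prod.case using assms(2,3) ij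
    by (simp add: open_expectation_cyl grid_def power_numeral_reduce power2_eq_square)
qed

text \<open>The error is \<open>10 * c * real n\<close> with \<open>c = 2\<close>, as the weight is
  a difference of two indicators.\<close>

lemma expected_components_le:
  assumes p: "0 \<le> p" "p \<le> 1"
  shows "open_expectation (grid n) p ncomps \<le> (p * (1 - p) ^ 3 - p ^ 3 * (1 - p) ^ 3) * (real n)\<^sup>2 + 20 * real n"
proof -
  have "open_expectation (grid n) p ncomps \<le> open_expectation (grid n) p (\<lambda>S. \<Sum>x\<in>S. upper_weight x S)"
    by (intro integral_mono card_comps_le_upper_weight) auto
  moreover have "\<bar>open_expectation (grid n) p (\<lambda>S. \<Sum>x\<in>S. upper_weight x S)
      - (p * (1 - p) ^ 3 - p ^ 3 * (1 - p) ^ 3) * (real n)\<^sup>2\<bar> \<le> 10 * 2 * real n"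
  proof (rule open_expectation_local_sum)
    show "upper_weight x S = 0" if "x \<notin> S" for x S
      using that by (auto simp: upper_weight_def cyl_def split: prod.splits)
    show "\<bar>upper_weight x S\<bar> \<le> 2" for x S
      by (auto simp: upper_weight_def cyl_def of_bool_def split: prod.splits)
    have "0 \<le> p ^ k * (1 - p) ^ l" "p ^ k * (1 - p) ^ l \<le> 1" for k l
      using p by (auto intro!: mult_le_one power_le_one)
    from this[of 1 3] this[of 3 3]
    show "\<bar>p * (1 - p) ^ 3 - p ^ 3 * (1 - p) ^ 3\<bar> \<le> 2" by simp
  qed (rule open_expectation_upper_weight[OF _ p])
  ultimately show ?thesis by simp
qed

text \<open>Here \<open>c = 7\<close>, because the weight combines seven indicators with
  signs.\<close>

lemma expected_components_ge:
  assumes p: "0 \<le> p" "p \<le> 1"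
  shows "open_expectation (grid n) p ncomps \<ge> (p - 3 * p\<^sup>2 + 2 * p ^ 3 + p ^ 6 * (1 - p)) * (real n)\<^sup>2 - 70 * real n"
proof -
  have "open_expectation (grid n) p ncomps \<ge> open_expectation (grid n) p (\<lambda>S. \<Sum>x\<in>S. lower_weight x S)"
    by (intro integral_mono card_comps_ge_lower_weight) auto
  moreover have "\<bar>open_expectation (grid n) p (\<lambda>S. \<Sum>x\<in>S. lower_weight x S)
      - (p - 3 * p\<^sup>2 + 2 * p ^ 3 + p ^ 6 * (1 - p)) * (real n)\<^sup>2\<bar> \<le> 10 * 7 * real n"
  proof (rule open_expectation_local_sum)
    show "lower_weight x S = 0" if "x \<notin> S" for x S
      using that by (auto simp: lower_weight_def cyl_def split: prod.splits)
    show "\<bar>lower_weight x S\<bar> \<le> 7" for x S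
    proof (cases x)
      case (Pair i j)
      have "\<bar>a - b - c - d + e + f + g\<bar> \<le> 7"
        if "0 \<le> a" "a \<le> 1" "0 \<le> b" "b \<le> 1" "0 \<le> c" "c \<le> 1" "0 \<le> d" "d \<le> 1" "0 \<le> e" "e \<le> 1"
          "0 \<le> f" "f \<le> 1" "0 \<le> g" "g \<le> 1" for a b c d e f g :: real
        using that by linarith
      then show ?thesis unfolding Pair lower_weight_def prod.case by (simp only: cyl_nonneg cyl_le_1)
    qed
    have "0 \<le> p ^ k" "p ^ k \<le> 1" for k using p by (auto intro!: power_le_one)
    moreover have "0 \<le> p ^ 6 * (1 - p)" "p ^ 6 * (1 - p) \<le> 1"
      using p by (auto intro!: mult_le_one power_le_one)
    ultimately show "\<bar>p - 3 * p\<^sup>2 + 2 * p ^ 3 + p ^ 6 * (1 - p)\<bar> \<le> 7"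
      using p by (smt (verit))
  qed (rule open_expectation_lower_weight[OF _ p])
  ultimately show ?thesis by simp
qed

text \<open>
  The maximum is attained near \<open>3/13\<close>. Division by \<open>(p - 3/13)^2\<close> leaves a remainder with positive
  coefficients, and so does the quotient in the Bernstein basis.
\<close>

lemma upper_polynomial_le:
  fixes p :: real
  assumes "0 \<le> p" "p \<le> 1"
  shows "p * (1 - p) ^ 3 - p ^ 3 * (1 - p) ^ 3 \<le> 101 / 1000"
proof -
  have "101 / 1000 - (p * (1 - p) ^ 3 - p ^ 3 * (1 - p) ^ 3) =
      (p - 3 / 13)\<^sup>2 * ((54000 / 28561) * (1 - p) ^ 4 + (144799 / 28561) * p * (1 - p) ^ 3
        + (88258 / 28561) * p\<^sup>2 * (1 - p)\<^sup>2 + (30620 / 28561) * p ^ 3 * (1 - p) + (4600 / 28561) * p ^ 4)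
      + 1507709 / 4826809000 + 2000 / 371293 * p"
    by (simp add: field_simps power_numeral_reduce)
  also have "\<dots> \<ge> 0"
    using assms by (intro add_nonneg_nonneg mult_nonneg_nonneg) auto
  finally show ?thesis by simp
qed

subsection \<open>Subadditivity and the limit\<close>

definition translate :: "int \<times> int \<Rightarrow> int \<times> int \<Rightarrow> int \<times> int" where
  "translate u = (\<lambda>(x, y). (x + fst u, y + snd u))"

lemma bij_translate: "bij (translate u)"
  by (rule o_bij[where g = "translate (- fst u, - snd u)"]) (auto simp: translate_def fun_eq_iff)

lemma translate_tri_adj: "(translate u x, translate u y) \<in> tri_adj \<longleftrightarrow> (x, y) \<in> tri_adj"
  by (cases x; cases y) (auto simp: translate_def tri_adj_def tri_step_def)

lemma translate_grid: "translate (a, b) ` grid m = {a + 1..a + int m} \<times> {b + 1..b + int m}"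
proof (intro set_eqI iffI)
  fix z assume "z \<in> {a + 1..a + int m} \<times> {b + 1..b + int m}"
  then show "z \<in> translate (a, b) ` grid m"
    by (intro image_eqI[where x = "(fst z - a, snd z - b)"]) (auto simp: translate_def grid_def)
qed (auto simp: translate_def grid_def)

lemma expected_components_translate:
  "open_expectation (translate u ` grid m) p ncomps = open_expectation (grid m) p ncomps"
  using open_expectation_bij[OF finite_grid bij_translate, where f = ncomps]
  by (simp add: card_comps_image[OF bij_is_inj[OF bij_translate] translate_tri_adj])

text \<open>The grid is cut into disjoint translates of \<open>grid m\<close> and a remainder, in
  which each open vertex accounts for at most one component.\<close>

lemma ncomps_grid_le:
  assumes m: "m > 0" and S: "S \<subseteq> grid n"
  shows "ncomps S \<le> (\<Sum>u\<in>{..<n div m} \<times> {..<n div m}.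
      ncomps (S \<inter> translate (int m * int (fst u), int m * int (snd u)) ` grid m)) + 2 * real m * real n"
proof -
  define k where "k = n div m"
  define T where "T u = translate (int m * int (fst u), int m * int (snd u)) ` grid m" for u :: "nat \<times> nat"
  define I where "I = {..<k} \<times> {..<k}"
  \<comment> \<open>The L-shaped remainder has width \<open>n - m * k < m\<close>, hence at most
    \<open>2 * m * n\<close> vertices.\<close>
  define D where "D = {int (m * k) + 1..int n} \<times> {1..int n} \<union> {1..int n} \<times> {int (m * k) + 1..int n}"
  have fin: "finite S" using S by (rule finite_subset) simp
  have cover: "z \<in> (\<Union>u\<in>I. T u) \<union> D" if "z \<in> grid n" for z
  proof -
    obtain x y where z: "z = (x, y)" by (cases z)
    have xy: "1 \<le> x" "x \<le> int n" "1 \<le> y" "y \<le> int n" using that by (auto simp: z grid_def)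
    have block: "\<exists>s<k. int m * int s + 1 \<le> x \<and> x \<le> int m * int s + int m" if "1 \<le> x" "x \<le> int (m * k)" for x
    proof (intro exI conjI)
      \<comment> \<open>Coordinates start at \<open>1\<close>, so block \<open>s\<close> covers
        \<open>m * s + 1\<close> to \<open>m * s + m\<close>, and its index comes from
        \<open>x - 1\<close>.\<close>
      let ?s = "(nat x - 1) div m"
      have "nat x \<le> m * k" "1 \<le> nat x" using that by (auto simp: nat_le_iff)
      then have "nat x - 1 < k * m" by (simp add: mult.commute[of k m])
      then show "?s < k" by (simp add: less_mult_imp_div_less)
      have "m * ?s + (nat x - 1) mod m = nat x - 1" by simp
      then have "int m * int ?s + int ((nat x - 1) mod m) = int (nat x - 1)" by (metis of_nat_add of_nat_mult)
      moreover have "int (nat x - 1) = x - 1" using that by simp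
      moreover have "(nat x - 1) mod m < m" using m by simp
      ultimately show "int m * int ?s + 1 \<le> x" "x \<le> int m * int ?s + int m" by linarith+
    qed
    show ?thesis
    proof (cases "x \<le> int (m * k) \<and> y \<le> int (m * k)")
      case True
      with block[of x] block[of y] xy obtain s t where
        "s < k" "int m * int s + 1 \<le> x" "x \<le> int m * int s + int m"
        "t < k" "int m * int t + 1 \<le> y" "y \<le> int m * int t + int m" by blast
      then have "(s, t) \<in> I" "z \<in> T (s, t)" by (auto simp: I_def T_def translate_grid z)
      then show ?thesis by blast
    next
      case False
      then show ?thesis using xy by (auto simp: z D_def)
    qed
  qed
  have "n - m * k < m" using m unfolding k_def by (metis minus_mult_div_eq_mod mod_less_divisor)
  then have r: "n - m * k \<le> m" by simp
  have "card D \<le> card ({int (m * k) + 1..int n} \<times> {1..int n}) + card ({1..int n} \<times> {int (m * k) + 1..int n})"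
    unfolding D_def by (rule card_Un_le)
  also have "\<dots> = 2 * ((n - m * k) * n)" by (simp add: card_cartesian_product nat_diff_distrib' nat_mult_distrib flip: of_nat_mult)
  also have "\<dots> \<le> 2 * (m * n)" using r by simp
  finally have D: "card D \<le> 2 * (m * n)" .
  have "finite D" by (simp add: D_def)
  have S_eq: "S = (\<Union>u\<in>I. S \<inter> T u) \<union> (S \<inter> D)" using cover S by blast
  have "card (comps tri_adj ((\<Union>u\<in>I. S \<inter> T u) \<union> (S \<inter> D)))
      \<le> card (comps tri_adj (\<Union>u\<in>I. S \<inter> T u)) + card (comps tri_adj (S \<inter> D))"
    using fin by (intro card_comps_Un_le sym_tri_adj) (auto simp: I_def)
  also have "card (comps tri_adj (\<Union>u\<in>I. S \<inter> T u)) \<le> (\<Sum>u\<in>I. card (comps tri_adj (S \<inter> T u)))"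
    using fin by (intro card_comps_UN_le sym_tri_adj) (auto simp: I_def)
  also have "card (comps tri_adj (S \<inter> D)) \<le> card (S \<inter> D)" using fin by (intro card_comps_le) auto
  also have "card (S \<inter> D) \<le> card D" using \<open>finite D\<close> by (intro card_mono) auto
  also note D
  finally have "card (comps tri_adj S) \<le> (\<Sum>u\<in>I. card (comps tri_adj (S \<inter> T u))) + 2 * (m * n)"
    using S_eq by simp
  then have "ncomps S \<le> real ((\<Sum>u\<in>I. card (comps tri_adj (S \<inter> T u))) + 2 * (m * n))"
    by (rule of_nat_mono)
  then show ?thesis by (simp add: I_def T_def k_def)
qed

text \<open>The configuration inside each tile is a marginal of the product measure, and translation
  invariance gives every tile the expectation of \<open>grid m\<close>.\<close>

lemma expected_components_subadditive:
  assumes m: "m > 0"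
  shows "open_expectation (grid n) p ncomps
    \<le> (real (n div m))\<^sup>2 * open_expectation (grid m) p ncomps + 2 * real m * real n"
proof -
  define k where "k = n div m"
  define T where "T u = translate (int m * int (fst u), int m * int (snd u)) ` grid m" for u :: "nat \<times> nat"
  define I where "I = {..<k} \<times> {..<k}"
  have T: "T u \<subseteq> grid n" if "u \<in> I" for u
  proof -
    obtain s t where u: "u = (s, t)" by (cases u)
    have *: "int m * int s + int m \<le> int n" if "s < k" for s
    proof -
      have "m * Suc s \<le> m * k" using that by (intro mult_le_mono) auto
      also have "\<dots> \<le> n" by (simp add: k_def)
      finally have "int (m * Suc s) \<le> int n" by (rule of_nat_mono)
      then show ?thesis by (simp add: algebra_simps)
    qed
    define A B where "A = int m * int s" and "B = int m * int t"
    have "T u = {A + 1..A + int m} \<times> {B + 1..B + int m}"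
      unfolding T_def u A_def B_def fst_conv snd_conv by (rule translate_grid)
    moreover have "0 \<le> A" "0 \<le> B" by (simp_all add: A_def B_def)
    moreover have "A + int m \<le> int n" "B + int m \<le> int n"
      using * that by (auto simp: u I_def A_def B_def)
    ultimately show ?thesis by (auto simp: grid_def)
  qed
  have "open_expectation (grid n) p ncomps \<le>
     open_expectation (grid n) p (\<lambda>S. (\<Sum>u\<in>I. ncomps (S \<inter> T u)) + 2 * real m * real n)"
    using ncomps_grid_le[OF m] by (intro integral_mono) (auto simp: I_def T_def k_def)
  also have "\<dots> = (\<Sum>u\<in>I. open_expectation (grid n) p (\<lambda>S. ncomps (S \<inter> T u))) + 2 * real m * real n"
    by simp
  also have "(\<Sum>u\<in>I. open_expectation (grid n) p (\<lambda>S. ncomps (S \<inter> T u)))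
      = (\<Sum>u\<in>I. open_expectation (grid m) p ncomps)"
  proof (rule sum.cong)
    fix u assume "u \<in> I"
    then show "open_expectation (grid n) p (\<lambda>S. ncomps (S \<inter> T u)) = open_expectation (grid m) p ncomps"
      using open_expectation_subset[OF finite_grid T, where f = ncomps] expected_components_translate
      by (simp add: T_def)
  qed simp
  finally show ?thesis by (simp add: I_def k_def power2_eq_square)
qed

section \<open>The supremum over \<open>p\<close>\<close>

definition max_expected :: "nat \<Rightarrow> real" where
  "max_expected n = (SUP p \<in> {0<..<1}. open_expectation (grid n) p ncomps)"

lemma expected_le_max:
  assumes "p \<in> {0<..<1}" shows "open_expectation (grid n) p ncomps \<le> max_expected n"
proof -
  interpret G: graph "with_proj (triangular_lattice n)" by (rule graph_triangular_lattice)
  have "bdd_above (range (\<lambda>p. open_expectation (grid n) p ncomps))"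
    using bdd_above_expected_components[OF G.wf_digraph_axioms G.finite_verts]
    unfolding expected_components_triangular .
  then have "bdd_above ((\<lambda>p. open_expectation (grid n) p ncomps) ` {0<..<1})"
    by (rule bdd_above_mono) auto
  with assms show ?thesis unfolding max_expected_def by (rule cSUP_upper)
qed

lemma max_expected_leI:
  assumes "\<And>p. p \<in> {0<..<1} \<Longrightarrow> open_expectation (grid n) p ncomps \<le> c"
  shows "max_expected n \<le> c"
  unfolding max_expected_def using assms by (intro cSUP_least) auto

lemma max_expected_nonneg: "0 \<le> max_expected n"
  by (rule order_trans[OF _ expected_le_max[of "1 / 2"]]) auto

text \<open>The error term does not depend on \<open>p\<close>, so subadditivity survives the
  supremum.\<close>

lemma max_expected_subadditive:
  assumes "m > 0"
  shows "max_expected n \<le> (real (n div m))\<^sup>2 * max_expected m + 2 * real m * real n"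
proof (rule max_expected_leI)
  fix p :: real assume "p \<in> {0<..<1}"
  then have "(real (n div m))\<^sup>2 * open_expectation (grid m) p ncomps \<le> (real (n div m))\<^sup>2 * max_expected m"
    by (intro mult_left_mono expected_le_max) auto
  then show "open_expectation (grid n) p ncomps \<le> (real (n div m))\<^sup>2 * max_expected m + 2 * real m * real n"
    using expected_components_subadditive[OF assms, of n p] by linarith
qed

lemma max_expected_density_le:
  assumes "m > 0" "n > 0"
  shows "max_expected n / (real n)\<^sup>2 \<le> max_expected m / (real m)\<^sup>2 + 2 * real m / real n"
proof -
  have "(real (n div m))\<^sup>2 \<le> (real n / real m)\<^sup>2"
    by (intro power_mono) (auto simp: of_nat_div_le_of_nat)
  then have "(real (n div m))\<^sup>2 * max_expected m \<le> (real n / real m)\<^sup>2 * max_expected m"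
    by (intro mult_right_mono max_expected_nonneg)
  then have "max_expected n \<le> (real n / real m)\<^sup>2 * max_expected m + 2 * real m * real n"
    using max_expected_subadditive[OF assms(1), of n] by linarith
  then have "max_expected n / (real n)\<^sup>2
      \<le> ((real n / real m)\<^sup>2 * max_expected m + 2 * real m * real n) / (real n)\<^sup>2"
    by (rule divide_right_mono) simp
  also have "\<dots> = max_expected m / (real m)\<^sup>2 + 2 * real m / real n"
    using assms by (simp add: field_simps power2_eq_square)
  finally show ?thesis .
qed

text \<open>A variant of Fekete's argument: the limit is the infimum, since for fixed
  \<open>m\<close> the error \<open>c m / real n\<close> vanishes.\<close>

lemma almost_decreasing_converges:
  fixes a c :: "nat \<Rightarrow> real"
  assumes nonneg: "\<And>n. n > 0 \<Longrightarrow> 0 \<le> a n"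
    and le: "\<And>m n. m > 0 \<Longrightarrow> n > 0 \<Longrightarrow> a n \<le> a m + c m / real n"
  shows "\<exists>L. a \<longlonglongrightarrow> L"
proof -
  \<comment> \<open>Index \<open>0\<close> is left out: in the application, division by zero makes
    \<open>a 0\<close> equal to \<open>0\<close>, which would spoil the infimum.\<close>
  let ?L = "INF n\<in>{0<..}. a n"
  have bdd: "bdd_below (a ` {0<..})" using nonneg by (auto intro!: bdd_belowI2)
  have "a \<longlonglongrightarrow> ?L"
  proof (rule LIMSEQ_I)
    fix e :: real assume e: "0 < e"
    then have "\<exists>x\<in>a ` {0<..}. x < ?L + e / 2"
      by (intro cInf_lessD) auto
    then obtain m where m: "m > 0" "a m < ?L + e / 2" by auto
    have "(\<lambda>n. c m / real n) \<longlonglongrightarrow> 0" by (rule lim_const_over_n)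
    then obtain N where N: "\<And>n. n \<ge> N \<Longrightarrow> norm (c m / real n) < e / 2"
      using LIMSEQ_D[of "\<lambda>n. c m / real n" 0 "e / 2"] e by auto
    show "\<exists>N. \<forall>n\<ge>N. norm (a n - ?L) < e"
    proof (intro exI allI impI)
      fix n assume n: "max N 1 \<le> n"
      then have "a n \<le> a m + c m / real n" "norm (c m / real n) < e / 2" using le m N by auto
      moreover have "?L \<le> a n" using bdd n by (intro cINF_lower) auto
      ultimately show "norm (a n - ?L) < e" using m(2) unfolding real_norm_def by linarith
    qed
  qed
  then show ?thesis ..
qed

theorem theorem3:
  shows "\<exists>L :: real.
    (\<lambda>n. (SUP p \<in> {0<..<1::real}. expected_components (with_proj (triangular_lattice n)) p)
            / real (n\<^sup>2)) \<longlonglongrightarrow> L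
    \<and> L \<in> {0.09629<..<0.10107}"
proof -
  let ?a = "\<lambda>n. max_expected n / (real n)\<^sup>2"
  obtain L where L: "?a \<longlonglongrightarrow> L"
    using almost_decreasing_converges[of ?a "\<lambda>m. 2 * real m"] max_expected_density_le max_expected_nonneg
    by auto
  \<comment> \<open>The point \<open>53 / 250\<close> is close to the maximiser, and the value is
    about \<open>0.096296\<close>. Without the term \<open>p ^ 6 * (1 - p)\<close> the maximum on
    the unit interval would be \<open>1 / (6 * sqrt 3)\<close>, about \<open>0.09623\<close>, which
    is too small.\<close>
  let ?q = "53 / 250 - 3 * (53 / 250)\<^sup>2 + 2 * (53 / 250) ^ 3 + (53 / 250) ^ 6 * (1 - 53 / 250) :: real"
  have upper: "?a n \<le> 101 / 1000 + 20 / real n" if "n > 0" for n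
  proof -
    have "max_expected n \<le> 101 / 1000 * (real n)\<^sup>2 + 20 * real n"
    proof (rule max_expected_leI)
      fix p :: real assume "p \<in> {0<..<1}"
      then have p: "0 \<le> p" "p \<le> 1" by auto
      have "(p * (1 - p) ^ 3 - p ^ 3 * (1 - p) ^ 3) * (real n)\<^sup>2 \<le> 101 / 1000 * (real n)\<^sup>2"
        using upper_polynomial_le[OF p] by (intro mult_right_mono) auto
      then show "open_expectation (grid n) p ncomps \<le> 101 / 1000 * (real n)\<^sup>2 + 20 * real n"
        using expected_components_le[OF p, of n] by linarith
    qed
    then have "?a n \<le> (101 / 1000 * (real n)\<^sup>2 + 20 * real n) / (real n)\<^sup>2"
      by (rule divide_right_mono) simp
    also have "\<dots> = 101 / 1000 + 20 / real n" using that by (simp add: field_simps power2_eq_square)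
    finally show ?thesis .
  qed
  have lower: "?q - 70 / real n \<le> ?a n" if "n > 0" for n
  proof -
    have "?q - 70 / real n = (?q * (real n)\<^sup>2 - 70 * real n) / (real n)\<^sup>2"
      using that by (simp add: diff_divide_distrib power2_eq_square)
    also have "\<dots> \<le> ?a n"
    proof (rule divide_right_mono)
      show "?q * (real n)\<^sup>2 - 70 * real n \<le> max_expected n"
        using expected_components_ge[of "53 / 250" n] expected_le_max[of "53 / 250" n] by simp
    qed simp
    finally show ?thesis .
  qed
  have "(\<lambda>n. 101 / 1000 + 20 / real n) \<longlonglongrightarrow> 101 / 1000 + 0"
    by (intro tendsto_add tendsto_const lim_const_over_n)
  \<comment> \<open>Limits preserve only weak inequalities; strictness comes from
    \<open>101 / 1000 < 0.10107\<close> and \<open>0.09629 < ?q\<close>.\<close>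
  then have "L \<le> 101 / 1000 + 0"
    by (rule LIMSEQ_le[OF L]) (use upper in \<open>auto intro: exI[of _ 1]\<close>)
  moreover have "(\<lambda>n. ?q - 70 / real n) \<longlonglongrightarrow> ?q - 0"
    by (intro tendsto_diff tendsto_const lim_const_over_n)
  then have "?q - 0 \<le> L"
    by (rule LIMSEQ_le[OF _ L]) (use lower in \<open>auto intro: exI[of _ 1]\<close>)
  ultimately have "L \<in> {0.09629<..<0.10107}" by (simp add: power_numeral_reduce)
  with L show ?thesis
    unfolding expected_components_triangular max_expected_def[symmetric] by auto
qed

end
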